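(* Let $G=(V,E)$ be a finite simple graph with $V=\{1,\dots,N\}$, and let $\tilde o$ be a partition of $V$ into independent sets (blocks), with $s$ blocks. Let $P_{\tilde o}=[0,1]^N\cap\{x\in\mathbb R^N: x_i=x_j \text{ whenever } i,j \text{ lie in the same block of }\tilde o\}$ and let $\mathcal H(G,\tilde o)$ be the arrangement consisting of the hyperplanes $x_i=x_j$ for $\{i,j\}\in E$ together with the hyperplanes $x_i=x_j$ for all $i,j$ lying in different blocks of $\tilde o$. Then for every positive integer $t$, $$(-1)^s E_{P_{\tilde o},\mathcal H(G,\tilde o)}(-t)=E^{\circ}_{\operatorname{relint}(P_{\tilde o}),\mathcal H(G,\tilde o)}(t)=\chi_{G,\tilde o}(t-1).$$ Furthermore, $\chi_{G,\tilde o}$ is a polynomial of degree $s$ with leading coefficient $1$.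
   Context: A proper $t$-coloring of $G$ is a map $c\colon V\to\{1,\dots,t\}$ with $c(i)\ne c(j)$ for every edge $\{i,j\}$. A coloring lies in $\tilde o$ if two vertices receive the same color exactly when they lie in the same block of $\tilde o$ (these partitions are exactly the orbits of proper colorings under permutation of colors). $\chi_{G,\tilde o}(t)$ denotes the number of proper $t$-colorings of $G$ lying in $\tilde o$. For a polytope $P$ and a hyperplane arrangement $\mathcal H$ in its affine hull: $E^{\circ}_{\operatorname{relint}(P),\mathcal H}(t)=\#\big(\mathbb Z^N\cap t[\operatorname{relint}(P)\setminus\bigcup\mathcal H]\big)$; the closed regions of $(tP,\mathcal H)$ are the closures of the connected components of $tP\setminus\bigcup\mathcal H$; $m_{tP,\mathcal H}(x)$ is the number of closed regions containing $x$ (and $0$ if $x\notin tP$); and $E_{P,\mathcal H}(t)=\sum_{x\in\mathbb Z^N}m_{tP,\mathcal H}(x)$, which is a polynomial in $t$ and is evaluated at $-t$ as such. *)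

theory Defs
  imports "HOL-Analysis.Analysis" "HOL-Library.Disjoint_Sets"
    "HOL-Computational_Algebra.Polynomial"
begin

text \<open>The vertex set is the whole finite type \<open>'n\<close>, so \<open>N = CARD('n)\<close>; an edge is the
  two-element set of its endpoints.\<close>

definition simple_graph_edges :: "'n set set \<Rightarrow> bool" where
  "simple_graph_edges E \<longleftrightarrow> (\<forall>e\<in>E. card e = 2)"

definition independent_in :: "'n set set \<Rightarrow> 'n set \<Rightarrow> bool" where
  "independent_in E B \<longleftrightarrow> (\<forall>i\<in>B. \<forall>j\<in>B. {i, j} \<notin> E)"

definition same_block :: "'n set set \<Rightarrow> 'n \<Rightarrow> 'n \<Rightarrow> bool" where
  "same_block \<pi> i j \<longleftrightarrow> (\<exists>B\<in>\<pi>. i \<in> B \<and> j \<in> B)"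

definition proper_coloring :: "'n set set \<Rightarrow> nat \<Rightarrow> ('n \<Rightarrow> nat) \<Rightarrow> bool" where
  "proper_coloring E t c \<longleftrightarrow> range c \<subseteq> {1..t} \<and> (\<forall>i j. {i, j} \<in> E \<longrightarrow> c i \<noteq> c j)"

definition coloring_lies_in :: "('n \<Rightarrow> nat) \<Rightarrow> 'n set set \<Rightarrow> bool" where
  "coloring_lies_in c \<pi> \<longleftrightarrow> (\<forall>i j. c i = c j \<longleftrightarrow> same_block \<pi> i j)"

definition orbital_chromatic :: "'n set set \<Rightarrow> 'n set set \<Rightarrow> nat \<Rightarrow> nat" where
  "orbital_chromatic E \<pi> t = card {c. proper_coloring E t c \<and> coloring_lies_in c \<pi>}"

definition integer_points :: "(real ^ 'n) set" where
  "integer_points = {x. \<forall>i. x $ i \<in> \<int>}"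

text \<open>Arrangements are sets of hyperplanes of the ambient space. Only \<open>P - \<Union>\<H>\<close> and
  \<open>tP - \<Union>\<H>\<close> matter below, so intersecting the hyperplanes with the affine hull of \<open>P\<close> would
  change nothing.\<close>

definition open_ehrhart :: "(real ^ 'n) set \<Rightarrow> (real ^ 'n) set set \<Rightarrow> nat \<Rightarrow> nat" where
  "open_ehrhart P \<H> t =
     card (integer_points \<inter> (\<lambda>x. real t *\<^sub>R x) ` (rel_interior P - \<Union>\<H>))"

definition closed_regions :: "(real ^ 'n) set \<Rightarrow> (real ^ 'n) set set \<Rightarrow> (real ^ 'n) set set" where
  "closed_regions Q \<H> = closure ` components (Q - \<Union>\<H>)"

definition region_multiplicity ::
    "(real ^ 'n) set \<Rightarrow> (real ^ 'n) set set \<Rightarrow> real ^ 'n \<Rightarrow> nat" where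
  "region_multiplicity Q \<H> x = (if x \<in> Q then card {R \<in> closed_regions Q \<H>. x \<in> R} else 0)"

text \<open>The Ehrhart counting functions are meant for \<open>t \<ge> 1\<close>: the dilate \<open>0P\<close> is a single point, and
  the literal count at \<open>t = 0\<close> need not be the value of the counting polynomial there. The sum over
  the lattice has finite support for bounded \<open>P\<close>.\<close>

definition closed_ehrhart :: "(real ^ 'n) set \<Rightarrow> (real ^ 'n) set set \<Rightarrow> nat \<Rightarrow> real" where
  "closed_ehrhart P \<H> t =
     (\<Sum>\<^sub>\<infinity>x\<in>integer_points. real (region_multiplicity ((\<lambda>x. real t *\<^sub>R x) ` P) \<H> x))"

definition orbit_polytope :: "'n set set \<Rightarrow> (real ^ 'n) set" where
  "orbit_polytope \<pi> =
     {x. \<forall>i. 0 \<le> x $ i \<and> x $ i \<le> 1} \<inter> {x. \<forall>i j. same_block \<pi> i j \<longrightarrow> x $ i = x $ j}"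

definition orbit_arrangement :: "'n set set \<Rightarrow> 'n set set \<Rightarrow> (real ^ 'n) set set" where
  "orbit_arrangement E \<pi> =
     {{x. x $ i = x $ j} | i j. {i, j} \<in> E} \<union>
     {{x. x $ i = x $ j} | i j. \<exists>A\<in>\<pi>. \<exists>B\<in>\<pi>. A \<noteq> B \<and> i \<in> A \<and> j \<in> B}"

end

theory Submission
  imports Defs
begin

text \<open>Off the arrangement, the points of \<open>tP\<close> are the injective functions from the \<open>s\<close> blocks to
  \<open>[0, t]\<close>, and the regions correspond to the \<open>s!\<close> orderings of the blocks. Hence the open count is
  the number of injections of the blocks into \<open>{1..t-1}\<close>, which is \<open>(t-1)(t-2)\<cdots>(t-s)\<close>. A pair of a
  lattice point \<open>y\<close> of \<open>tP\<close> and a closed region containing it, encoded by the rank function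
  \<open>r\<close> of the ordering, is equivalent to the injection \<open>y + r\<close> of the blocks into
  \<open>{0..t+s-1}\<close>; so the closed count is \<open>(t+s)(t+s-1)\<cdots>(t+1)\<close>, and reciprocity is visible from the
  two products.\<close>

subsection \<open>Colorings and rankings\<close>

text \<open>The palette \<open>A\<close> is left free because three are used: \<open>{1..t}\<close>
  for graph colorings, \<open>{..<card \<pi>}\<close> for the rankings that order the blocks, and
  \<open>{..<t + card \<pi>}\<close> for sums of a lattice point and a ranking. When the blocks are
  independent, lying in \<open>\<pi>\<close> already makes a coloring proper.\<close>

definition colorings :: "'n set set \<Rightarrow> nat set \<Rightarrow> ('n \<Rightarrow> nat) set" where
  "colorings \<pi> A = {c. range c \<subseteq> A \<and> coloring_lies_in c \<pi>}"

lemma coloringsI: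
  "(\<And>i. c i \<in> A) \<Longrightarrow> (\<And>i j. c i = c j \<longleftrightarrow> same_block \<pi> i j) \<Longrightarrow> c \<in> colorings \<pi> A"
  by (auto simp: colorings_def coloring_lies_in_def)

lemma colorings_mem: "c \<in> colorings \<pi> A \<Longrightarrow> c i \<in> A"
  by (auto simp: colorings_def)

lemma colorings_eq_iff: "c \<in> colorings \<pi> A \<Longrightarrow> c i = c j \<longleftrightarrow> same_block \<pi> i j"
  by (auto simp: colorings_def coloring_lies_in_def)

text \<open>Both images are copies of the quotient of \<open>S\<close> by the common kernel, so
  sending \<open>f x\<close> to \<open>g x\<close> is a well-defined bijection.\<close>

lemma card_image_eq_kernel:
  assumes "\<And>x y. x \<in> S \<Longrightarrow> y \<in> S \<Longrightarrow> f x = f y \<longleftrightarrow> g x = g y"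
  shows "card (f ` S) = card (g ` S)"
proof (rule bij_betw_same_card)
  have inv: "inv_into S f (f x) \<in> S \<and> g (inv_into S f (f x)) = g x" if "x \<in> S" for x
    using that assms by (metis f_inv_into_f imageI inv_into_into)
  show "bij_betw (\<lambda>v. g (inv_into S f v)) (f ` S) (g ` S)"
    unfolding bij_betw_def
  proof
    show "inj_on (\<lambda>v. g (inv_into S f v)) (f ` S)"
      using inv assms by (auto intro!: inj_onI)
    show "(\<lambda>v. g (inv_into S f v)) ` f ` S = g ` S"
      using inv by (force simp: image_image)
  qed
qed

lemma partition_block_map:
  assumes "partition_on UNIV \<pi>"
  obtains b where "range b = \<pi>" "\<And>i j. b i = b j \<longleftrightarrow> same_block \<pi> i j"
proof -
  have ex: "\<forall>i. \<exists>B\<in>\<pi>. i \<in> B"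
    using assms by (auto simp: partition_on_def)
  then obtain b where b: "\<And>i. b i \<in> \<pi>" "\<And>i. i \<in> b i"
    by metis
  have uniq: "b i = B" if "B \<in> \<pi>" "i \<in> B" for i B
    using that b assms by (metis disjointD disjoint_iff partition_onD2)
  have "range b = \<pi>"
  proof
    show "\<pi> \<subseteq> range b"
    proof
      fix B assume B: "B \<in> \<pi>"
      then obtain i where "i \<in> B"
        using assms by (metis partition_onD3 equals0I)
      with B uniq show "B \<in> range b" by blast
    qed
  qed (use b in auto)
  moreover have "b i = b j \<longleftrightarrow> same_block \<pi> i j" for i j
    using b uniq unfolding same_block_def by metis
  ultimately show thesis using that by blast
qed

lemma card_range_same_block:
  assumes "partition_on UNIV \<pi>" "\<And>i j. f i = f j \<longleftrightarrow> same_block \<pi> i j"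
  shows "card (range f) = card \<pi>"
proof -
  obtain b where b: "range b = \<pi>" "\<And>i j. b i = b j \<longleftrightarrow> same_block \<pi> i j"
    using partition_block_map[OF assms(1)] by blast
  have "card (range f) = card (range b)"
    by (rule card_image_eq_kernel) (simp add: assms(2) b(2))
  with b show ?thesis by simp
qed

text \<open>Truncated subtraction does no harm: for \<open>n < s\<close> both products contain the
  zero factor \<open>i = n\<close>.\<close>

lemma real_prod_falling: "real (\<Prod>i<s. n - i) = (\<Prod>i<s. real n - real i)"
proof (cases "s \<le> n")
  case True
  then show ?thesis by (simp add: of_nat_diff)
next
  case False
  then have n: "n < s" by simp
  have "(\<Prod>i<s. n - i) = 0" "(\<Prod>i<s. real n - real i) = 0"
    using n by (intro prod_zero; force)+
  then show ?thesis by (simp only: of_nat_0)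
qed

text \<open>A coloring lying in \<open>\<pi>\<close> factors uniquely through the block map
  \<open>b\<close> as an injection from the blocks into \<open>A\<close>, and injections are counted
  by the falling factorial.\<close>

lemma card_colorings:
  fixes \<pi> :: "'n::finite set set"
  assumes \<pi>: "partition_on UNIV \<pi>" and A: "finite A"
  shows "card (colorings \<pi> A) = (\<Prod>i<card \<pi>. card A - i)"
proof -
  obtain b where b: "range b = \<pi>" "\<And>i j. b i = b j \<longleftrightarrow> same_block \<pi> i j"
    using partition_block_map[OF \<pi>] by blast
  let ?F = "{g \<in> \<pi> \<rightarrow>\<^sub>E A. inj_on g \<pi>}"
  have "bij_betw (\<lambda>g. g \<circ> b) ?F (colorings \<pi> A)"
    unfolding bij_betw_def
  proof
    show "inj_on (\<lambda>g. g \<circ> b) ?F"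
    proof (rule inj_onI)
      fix g h assume gh: "g \<in> ?F" "h \<in> ?F" "g \<circ> b = h \<circ> b"
      have "g B = h B" if "B \<in> \<pi>" for B
        using that gh(3) b(1) by (metis comp_apply imageE)
      with gh show "g = h"
        by (auto intro: PiE_ext)
    qed
    show "(\<lambda>g. g \<circ> b) ` ?F = colorings \<pi> A"
    proof (intro subset_antisym subsetI)
      fix c assume "c \<in> (\<lambda>g. g \<circ> b) ` ?F"
      then obtain g where g: "g \<in> \<pi> \<rightarrow>\<^sub>E A" "inj_on g \<pi>" "c = g \<circ> b" by auto
      show "c \<in> colorings \<pi> A"
      proof (rule coloringsI)
        show "c i \<in> A" for i using g b(1) by auto
        show "c i = c j \<longleftrightarrow> same_block \<pi> i j" for i j
          using g(2,3) b by (metis comp_apply inj_on_eq_iff rangeI)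
      qed
    next
      fix c assume c: "c \<in> colorings \<pi> A"
      let ?g = "restrict (c \<circ> inv b) \<pi>"
      \<comment> \<open>\<open>inv b (b i)\<close> need not be \<open>i\<close>, but it lies in the
        same block, where \<open>c\<close> is constant.\<close>
      have inv: "c (inv b (b i)) = c i" for i
        using colorings_eq_iff[OF c] b(2) by (metis f_inv_into_f rangeI)
      have "?g \<in> ?F"
      proof -
        have "inj_on ?g \<pi>"
        proof (rule inj_onI)
          fix B C assume BC: "B \<in> \<pi>" "C \<in> \<pi>" "?g B = ?g C"
          then obtain i j where "B = b i" "C = b j" using b(1) by blast
          with BC inv colorings_eq_iff[OF c] b(2) show "B = C" by simp
        qed
        then show ?thesis using colorings_mem[OF c] by auto
      qed
      moreover have "c = ?g \<circ> b" using inv b(1) by (auto simp: fun_eq_iff)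
      ultimately show "c \<in> (\<lambda>g. g \<circ> b) ` ?F" by blast
    qed
  qed
  then have "card (colorings \<pi> A) = card ?F" by (simp add: bij_betw_same_card)
  also have "\<dots> = (\<Prod>i<card \<pi>. card A - i)"
    using card_inj_on_subset_funcset[of \<pi> A \<pi>] A by (simp add: atLeast0LessThan)
  finally show ?thesis .
qed

section \<open>Value ranks\<close>

text \<open>Distinct values below \<open>f i\<close> are counted, not indices, so the ranks have no
  gaps even though \<open>f\<close> repeats on blocks. The codomain is any linear order, since both
  real vectors and natural-valued functions get ranked.\<close>

definition value_rank :: "('n \<Rightarrow> 'b::linorder) \<Rightarrow> 'n \<Rightarrow> nat" where
  "value_rank f i = card (f ` {k. f k < f i})"

lemma value_rank_less_iff:
  fixes f :: "'n::finite \<Rightarrow> 'b::linorder"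
  shows "value_rank f i < value_rank f j \<longleftrightarrow> f i < f j"
proof -
  have less: "value_rank f i < value_rank f j" if "f i < f j" for i j
    unfolding value_rank_def using that by (intro psubset_card_mono) force+
  show ?thesis
  proof (cases "f i < f j")
    case False
    then consider "f i = f j" | "f j < f i" by fastforce
    then show ?thesis
      using less[of j i] by cases (auto simp: value_rank_def)
  qed (simp add: less)
qed

lemma value_rank_eq_iff:
  fixes f :: "'n::finite \<Rightarrow> 'b::linorder"
  shows "value_rank f i = value_rank f j \<longleftrightarrow> f i = f j"
  using value_rank_less_iff by (metis linorder_neq_iff)

lemma value_rank_less_card_range:
  fixes f :: "'n::finite \<Rightarrow> 'b::linorder"
  shows "value_rank f i < card (range f)"
proof -
  have "f i \<notin> f ` {k. f k < f i}" by auto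
  then show ?thesis
    unfolding value_rank_def by (intro psubset_card_mono) auto
qed

text \<open>In a linear order the strict comparisons determine the ties, so the two sets of smaller
  values are images with the same kernel.\<close>

lemma value_rank_cong:
  assumes "\<And>i j. f i < f j \<longleftrightarrow> g i < g j"
  shows "value_rank f = value_rank g"
proof
  fix i
  have "f x = f y \<longleftrightarrow> g x = g y" for x y
    using assms by (metis linorder_neq_iff)
  then show "value_rank f i = value_rank g i"
    unfolding value_rank_def assms by (rule card_image_eq_kernel)
qed

lemma value_rank_colorings:
  fixes f :: "'n::finite \<Rightarrow> 'b::linorder"
  assumes "partition_on UNIV \<pi>" "\<And>i j. f i = f j \<longleftrightarrow> same_block \<pi> i j"
  shows "value_rank f \<in> colorings \<pi> {..<card \<pi>}"
  using value_rank_less_card_range[of f] card_range_same_block[OF assms]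
  by (intro coloringsI) (simp_all add: assms(2) value_rank_eq_iff)

text \<open>A ranking takes \<open>card \<pi>\<close> distinct values below
  \<open>card \<pi>\<close>, hence all of them, so exactly \<open>r i\<close> values lie below
  \<open>r i\<close>.\<close>

lemma value_rank_ranking:
  fixes r :: "'n::finite \<Rightarrow> nat"
  assumes "partition_on UNIV \<pi>" "r \<in> colorings \<pi> {..<card \<pi>}"
  shows "value_rank r = r"
proof
  fix i
  have "card (range r) = card \<pi>"
    using assms by (intro card_range_same_block) (auto simp: colorings_eq_iff)
  then have "range r = {..<card \<pi>}"
    using colorings_mem[OF assms(2)] by (intro card_subset_eq) auto
  moreover have "r ` {k. r k < r i} = range r \<inter> {..<r i}"
    by auto
  ultimately have "r ` {k. r k < r i} = {..<r i}"
    using colorings_mem[OF assms(2), of i] by auto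
  then show "value_rank r i = r i"
    by (simp add: value_rank_def)
qed

text \<open>One implication suffices: \<open>r\<close> and \<open>r'\<close> tie on the same pairs,
  namely within blocks, so by trichotomy preserving strict order also reflects it.\<close>

lemma ranking_eqI:
  fixes r r' :: "'n::finite \<Rightarrow> nat"
  assumes "partition_on UNIV \<pi>" "r \<in> colorings \<pi> {..<card \<pi>}" "r' \<in> colorings \<pi> {..<card \<pi>}"
    and "\<And>i j. r i < r j \<Longrightarrow> r' i < r' j"
  shows "r = r'"
proof -
  have "r i < r j \<longleftrightarrow> r' i < r' j" for i j
    using assms(4) colorings_eq_iff[OF assms(2)] colorings_eq_iff[OF assms(3)]
    by (metis linorder_neq_iff order_less_asym)
  then have "value_rank r = value_rank r'" by (rule value_rank_cong)
  then show ?thesis using value_rank_ranking assms(1-3) by metis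
qed

section \<open>Block functions paired with compatible rankings\<close>

definition block_functions :: "'n set set \<Rightarrow> nat \<Rightarrow> ('n \<Rightarrow> nat) set" where
  "block_functions \<pi> t = {y. (\<forall>i. y i \<le> t) \<and> (\<forall>i j. same_block \<pi> i j \<longrightarrow> y i = y j)}"

text \<open>These rankings will index the closed regions through \<open>y\<close>. The inequality is
  weak because a point on a wall, where different blocks share a value, belongs to several
  regions.\<close>

definition compatible_rankings :: "'n set set \<Rightarrow> ('n \<Rightarrow> 'a::linorder) \<Rightarrow> ('n \<Rightarrow> nat) set" where
  "compatible_rankings \<pi> y =
     {r \<in> colorings \<pi> {..<card \<pi>}. \<forall>i j. r i < r j \<longrightarrow> y i \<le> y j}"

lemma finite_block_functions:
  fixes \<pi> :: "'n::finite set set"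
  shows "finite (block_functions \<pi> t)"
proof (rule finite_subset)
  show "block_functions \<pi> t \<subseteq> (UNIV :: 'n set) \<rightarrow>\<^sub>E {..t}"
    by (auto simp: block_functions_def)
qed (auto intro: finite_PiE)

lemma finite_colorings:
  fixes \<pi> :: "'n::finite set set"
  assumes "finite A"
  shows "finite (colorings \<pi> A)"
proof (rule finite_subset)
  show "colorings \<pi> A \<subseteq> (UNIV :: 'n set) \<rightarrow>\<^sub>E A"
    by (auto simp: colorings_def)
qed (use assms in \<open>auto intro: finite_PiE\<close>)

text \<open>A block function \<open>y\<close> and a compatible ranking \<open>r\<close> are both recovered from \<open>z = y + r\<close>: the
  ranking is the value rank of \<open>z\<close>.\<close>

lemma bij_betw_add_ranking:
  fixes \<pi> :: "'n::finite set set"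
  assumes \<pi>: "partition_on UNIV \<pi>"
  shows "bij_betw (\<lambda>(y, r) i. y i + r i)
           (SIGMA y : block_functions \<pi> t. compatible_rankings \<pi> y) (colorings \<pi> {..<t + card \<pi>})"
    (is "bij_betw ?f ?S ?C")
  unfolding bij_betw_def
proof
  \<comment> \<open>Adding \<open>y\<close> preserves the order of \<open>r\<close>: it is weakly
    increasing along \<open>r\<close>, and equal ranks mean the same block, hence equal values of
    \<open>y\<close>.\<close>
  have less: "r i < r j \<longleftrightarrow> y i + r i < y j + r j"
    if "y \<in> block_functions \<pi> t" "r \<in> compatible_rankings \<pi> y" for y r i j
  proof -
    have r: "r \<in> colorings \<pi> {..<card \<pi>}" "\<And>i j. r i < r j \<Longrightarrow> y i \<le> y j"
      using that by (auto simp: compatible_rankings_def)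
    consider "r i < r j" | "r j < r i" | "r i = r j" by linarith
    then show ?thesis
    proof cases
      case 3
      then have "y i = y j"
        using that colorings_eq_iff[OF r(1)] by (auto simp: block_functions_def)
      with 3 show ?thesis by simp
    qed (use r(2)[of i j] r(2)[of j i] in auto)
  qed
  have rank: "value_rank (\<lambda>i. y i + r i) = r"
    if yr: "y \<in> block_functions \<pi> t" "r \<in> compatible_rankings \<pi> y" for y r
  proof -
    have "value_rank (\<lambda>i. y i + r i) = value_rank r"
      using less[OF yr] by (intro value_rank_cong) simp
    also have "\<dots> = r"
      using yr by (intro value_rank_ranking[OF \<pi>]) (auto simp: compatible_rankings_def)
    finally show ?thesis .
  qed
  show "inj_on ?f ?S"
  proof (rule inj_onI, clarsimp)
    fix y r y' r'
    assume *: "y \<in> block_functions \<pi> t" "r \<in> compatible_rankings \<pi> y"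
      "y' \<in> block_functions \<pi> t" "r' \<in> compatible_rankings \<pi> y'"
      and eq: "(\<lambda>i. y i + r i) = (\<lambda>i. y' i + r' i)"
    have "r = r'" using rank[OF *(1,2)] rank[OF *(3,4)] eq by simp
    moreover from this have "y = y'" using eq by (auto simp: fun_eq_iff)
    ultimately show "y = y' \<and> r = r'" by simp
  qed
  show "?f ` ?S = ?C"
  proof (intro subset_antisym subsetI)
    fix z assume "z \<in> ?f ` ?S"
    then obtain y r where z: "z = (\<lambda>i. y i + r i)" and
      yr: "y \<in> block_functions \<pi> t" "r \<in> compatible_rankings \<pi> y" by auto
    have r: "r \<in> colorings \<pi> {..<card \<pi>}" using yr by (auto simp: compatible_rankings_def)
    show "z \<in> ?C"
    proof (rule coloringsI)
      fix i j
      have "y i \<le> t" using yr by (auto simp: block_functions_def)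
      then show "z i \<in> {..<t + card \<pi>}" using colorings_mem[OF r, of i] z by auto
      show "z i = z j \<longleftrightarrow> same_block \<pi> i j"
        using less[OF yr] colorings_eq_iff[OF r, of i j] z by (metis linorder_neq_iff)
    qed
  next
    fix z assume z: "z \<in> ?C"
    define r where "r = value_rank z"
    define y where "y i = z i - r i" for i
    have r: "r \<in> colorings \<pi> {..<card \<pi>}"
      unfolding r_def using z by (intro value_rank_colorings[OF \<pi>]) (rule colorings_eq_iff)
    \<comment> \<open>The \<open>r i\<close> distinct values of \<open>z\<close> below
      \<open>z i\<close> are natural numbers below \<open>z i\<close>. Hence the subtraction
      defining \<open>y\<close> is exact.\<close>
    have le: "r i \<le> z i" for i
    proof -
      have "r i \<le> card {..<z i}"
        unfolding r_def value_rank_def by (intro card_mono) auto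
      then show ?thesis by simp
    qed
    \<comment> \<open>From \<open>z i\<close> up to \<open>z j\<close> the rank grows by at most
      \<open>z j - z i\<close>, the number of integers available; so \<open>z - r\<close> is weakly
      increasing along \<open>z\<close>.\<close>
    have gap: "r j + z i \<le> r i + z j" if "z i < z j" for i j
    proof -
      have "r j \<le> card (z ` {k. z k < z i} \<union> {z i..<z j})"
        unfolding r_def value_rank_def by (intro card_mono) auto
      also have "\<dots> \<le> r i + (z j - z i)"
        unfolding r_def value_rank_def by (rule order_trans[OF card_Un_le]) simp
      finally show ?thesis using that by linarith
    qed
    \<comment> \<open>Of the \<open>card \<pi>\<close> values of \<open>z\<close>,
      \<open>r i\<close> lie below \<open>z i\<close> and the others fit into
      \<open>{z i..<t + card \<pi>}\<close>. Comparing sizes gives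
      \<open>y i \<le> t\<close>.\<close>
    have top: "z i \<le> r i + t" for i
    proof -
      have "card \<pi> = card (range z)"
        by (rule card_range_same_block[OF \<pi>, symmetric]) (rule colorings_eq_iff[OF z])
      also have "\<dots> \<le> card (z ` {k. z k < z i} \<union> {z i..<t + card \<pi>})"
        using colorings_mem[OF z] by (intro card_mono) fastforce+
      also have "\<dots> \<le> r i + (t + card \<pi> - z i)"
        unfolding r_def value_rank_def by (rule order_trans[OF card_Un_le]) simp
      finally show ?thesis using colorings_mem[OF z, of i] by auto
    qed
    have "y \<in> block_functions \<pi> t"
      unfolding block_functions_def
    proof (intro CollectI conjI allI impI)
      show "y i \<le> t" for i using top[of i] by (simp add: y_def)
      show "y i = y j" if "same_block \<pi> i j" for i j
        using that colorings_eq_iff[OF z, of i j] colorings_eq_iff[OF r, of i j]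
        by (simp add: y_def)
    qed
    moreover have "r \<in> compatible_rankings \<pi> y"
      unfolding compatible_rankings_def
    proof (intro CollectI conjI allI impI r)
      fix i j assume "r i < r j"
      then have "z i < z j" by (simp add: r_def value_rank_less_iff)
      then show "y i \<le> y j" using gap[of i j] le[of i] le[of j] by (simp add: y_def)
    qed
    moreover have "z = ?f (y, r)" using le by (auto simp: y_def)
    ultimately show "z \<in> ?f ` ?S" by blast
  qed
qed

lemma sum_card_compatible_rankings:
  fixes \<pi> :: "'n::finite set set"
  assumes \<pi>: "partition_on UNIV \<pi>"
  shows "(\<Sum>y\<in>block_functions \<pi> t. card (compatible_rankings \<pi> y)) = (\<Prod>i<card \<pi>. t + card \<pi> - i)"
proof -
  have "finite (compatible_rankings \<pi> y)" for y :: "'n \<Rightarrow> nat"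
    by (rule finite_subset[OF _ finite_colorings[of "{..<card \<pi>}" \<pi>]])
      (auto simp: compatible_rankings_def)
  then have "(\<Sum>y\<in>block_functions \<pi> t. card (compatible_rankings \<pi> y)) =
      card (SIGMA y : block_functions \<pi> t. compatible_rankings \<pi> y)"
    by (simp add: finite_block_functions)
  also have "\<dots> = card (colorings \<pi> {..<t + card \<pi>})"
    by (rule bij_betw_same_card[OF bij_betw_add_ranking[OF \<pi>]])
  also have "\<dots> = (\<Prod>i<card \<pi>. t + card \<pi> - i)"
    by (simp add: card_colorings[OF \<pi>])
  finally show ?thesis .
qed

subsection \<open>The geometry of the orbit polytope\<close>

lemma same_block_refl: "partition_on UNIV \<pi> \<Longrightarrow> same_block \<pi> i i"
  by (auto simp: same_block_def partition_on_def)

text \<open>Blocks are independent, so an edge joins different blocks; blocks are disjoint, so lying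
  in different blocks is the same as not sharing one.\<close>

lemma Union_orbit_arrangement:
  fixes E \<pi> :: "'n::finite set set"
  assumes \<pi>: "partition_on UNIV \<pi>" and indep: "\<forall>B\<in>\<pi>. independent_in E B"
  shows "\<Union>(orbit_arrangement E \<pi>) = {x. \<exists>i j. \<not> same_block \<pi> i j \<and> x $ i = x $ j}"
proof -
  have edge: "\<not> same_block \<pi> i j" if "{i, j} \<in> E" for i j
    using that indep by (auto simp: same_block_def independent_in_def)
  have other: "\<not> same_block \<pi> i j \<longleftrightarrow> (\<exists>A\<in>\<pi>. \<exists>B\<in>\<pi>. A \<noteq> B \<and> i \<in> A \<and> j \<in> B)" for i j
  proof -
    obtain A B where "A \<in> \<pi>" "i \<in> A" "B \<in> \<pi>" "j \<in> B"
      using same_block_refl[OF \<pi>] unfolding same_block_def by metis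
    moreover have "C = D" if "C \<in> \<pi>" "D \<in> \<pi>" "k \<in> C" "k \<in> D" for C D k
      using partition_onD2[OF \<pi>] that by (metis disjointD disjoint_iff)
    ultimately show ?thesis unfolding same_block_def by metis
  qed
  have "\<Union>{{x :: real ^ 'n. x $ i = x $ j} | i j. R i j} = {x. \<exists>i j. R i j \<and> x $ i = x $ j}"
    for R :: "'n \<Rightarrow> 'n \<Rightarrow> bool"
    by blast
  then have "\<Union>(orbit_arrangement E \<pi>) =
      {x. \<exists>i j. {i, j} \<in> E \<and> x $ i = x $ j} \<union> {x. \<exists>i j. \<not> same_block \<pi> i j \<and> x $ i = x $ j}"
    unfolding orbit_arrangement_def Union_Un_distrib other by simp
  with edge show ?thesis by auto
qed

text \<open>With \<open>A = {0..a}\<close> this describes the dilated polytope off the arrangement,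
  with \<open>A = {0<..<a}\<close> its relative interior off the arrangement.\<close>

definition generic_points :: "'n set set \<Rightarrow> real set \<Rightarrow> (real ^ 'n) set" where
  "generic_points \<pi> A = {x. (\<forall>i. x $ i \<in> A) \<and> (\<forall>i j. x $ i = x $ j \<longleftrightarrow> same_block \<pi> i j)}"

lemma scaled_orbit_polytope:
  fixes \<pi> :: "'n::finite set set"
  assumes "a > 0"
  shows "(\<lambda>x. a *\<^sub>R x) ` orbit_polytope \<pi> =
    {x. (\<forall>i. 0 \<le> x $ i \<and> x $ i \<le> a) \<and> (\<forall>i j. same_block \<pi> i j \<longrightarrow> x $ i = x $ j)}"
proof (intro subset_antisym subsetI)
  fix x assume "x \<in> {x. (\<forall>i. 0 \<le> x $ i \<and> x $ i \<le> a) \<and> (\<forall>i j. same_block \<pi> i j \<longrightarrow> x $ i = x $ j)}"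
  then have "(1 / a) *\<^sub>R x \<in> orbit_polytope \<pi>" "x = a *\<^sub>R ((1 / a) *\<^sub>R x)"
    using assms by (auto simp: orbit_polytope_def)
  then show "x \<in> (\<lambda>x. a *\<^sub>R x) ` orbit_polytope \<pi>" by blast
qed (use assms in \<open>auto simp: orbit_polytope_def mult_left_le\<close>)

text \<open>The polytope is the unit cube cut by a linear subspace that meets the open cube, so its
  relative interior is the open cube cut by that subspace.\<close>

lemma rel_interior_orbit_polytope:
  fixes \<pi> :: "'n::finite set set"
  shows "rel_interior (orbit_polytope \<pi>) =
    {x. (\<forall>i. 0 < x $ i \<and> x $ i < 1) \<and> (\<forall>i j. same_block \<pi> i j \<longrightarrow> x $ i = x $ j)}"
proof -
  define T :: "(real ^ 'n) set" where "T = {x. \<forall>i j. same_block \<pi> i j \<longrightarrow> x $ i = x $ j}"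
  have P: "orbit_polytope \<pi> = cbox 0 1 \<inter> T"
    by (auto simp: orbit_polytope_def T_def mem_box_cart)
  have box: "rel_interior (cbox 0 (1 :: real ^ 'n)) = box 0 1"
  proof -
    have "(\<chi> i. 1 / 2) \<in> box 0 (1 :: real ^ 'n)" by (simp add: mem_box_cart)
    then show ?thesis using rel_interior_nonempty_interior[of "cbox 0 (1 :: real ^ 'n)"]
      by (metis empty_iff interior_cbox)
  qed
  \<comment> \<open>The centre of the cube has all coordinates equal, so it satisfies every block
    equation.\<close>
  have "(\<chi> i. 1 / 2) \<in> box 0 1 \<inter> T" by (simp add: mem_box_cart T_def)
  moreover have "affine T"
    unfolding affine_def T_def by simp
  ultimately have "rel_interior (cbox 0 1 \<inter> T) = box 0 1 \<inter> T"
    by (subst convex_affine_rel_interior_Int) (auto simp: box)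
  then show ?thesis unfolding P by (auto simp: mem_box_cart T_def)
qed

lemma scaled_orbit_polytope_Diff:
  fixes E \<pi> :: "'n::finite set set"
  assumes "partition_on UNIV \<pi>" "\<forall>B\<in>\<pi>. independent_in E B" "a > 0"
  shows "(\<lambda>x. a *\<^sub>R x) ` orbit_polytope \<pi> - \<Union>(orbit_arrangement E \<pi>) = generic_points \<pi> {0..a}"
  unfolding scaled_orbit_polytope[OF assms(3)] Union_orbit_arrangement[OF assms(1,2)]
  by (auto simp: generic_points_def)

lemma scaled_rel_interior_orbit_polytope_Diff:
  fixes E \<pi> :: "'n::finite set set"
  assumes "partition_on UNIV \<pi>" "\<forall>B\<in>\<pi>. independent_in E B" "a > 0"
  shows "(\<lambda>x. a *\<^sub>R x) ` (rel_interior (orbit_polytope \<pi>) - \<Union>(orbit_arrangement E \<pi>)) =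
    generic_points \<pi> {0<..<a}"
proof -
  have 1: "rel_interior (orbit_polytope \<pi>) - \<Union>(orbit_arrangement E \<pi>) = generic_points \<pi> {0<..<1}"
    unfolding rel_interior_orbit_polytope Union_orbit_arrangement[OF assms(1,2)]
    by (auto simp: generic_points_def)
  show ?thesis
    unfolding 1
  proof (intro subset_antisym subsetI)
    fix x assume "x \<in> generic_points \<pi> {0<..<a}"
    then have "(1 / a) *\<^sub>R x \<in> generic_points \<pi> {0<..<1}" "x = a *\<^sub>R ((1 / a) *\<^sub>R x)"
      using assms(3) by (auto simp: generic_points_def)
    then show "x \<in> (\<lambda>x. a *\<^sub>R x) ` generic_points \<pi> {0<..<1}" by blast
  qed (use assms(3) in \<open>auto simp: generic_points_def\<close>)
qed

section \<open>Order cells and closed regions\<close>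

definition order_cell :: "'n set set \<Rightarrow> real \<Rightarrow> ('n \<Rightarrow> nat) \<Rightarrow> (real ^ 'n) set" where
  "order_cell \<pi> a r = {x. (\<forall>i. 0 \<le> x $ i \<and> x $ i \<le> a) \<and>
     (\<forall>i j. same_block \<pi> i j \<longrightarrow> x $ i = x $ j) \<and> (\<forall>i j. r i < r j \<longrightarrow> x $ i \<le> x $ j)}"

text \<open>Only the comparisons between blocks are strict. The bounds \<open>0\<close> and
  \<open>a\<close> stay weak, since the regions are cut out of the closed dilate.\<close>

definition open_order_cell :: "'n set set \<Rightarrow> real \<Rightarrow> ('n \<Rightarrow> nat) \<Rightarrow> (real ^ 'n) set" where
  "open_order_cell \<pi> a r = {x \<in> generic_points \<pi> {0..a}. \<forall>i j. r i < r j \<longleftrightarrow> x $ i < x $ j}"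

text \<open>Trichotomy on \<open>r i\<close> and \<open>r j\<close> recovers the equivalences,
  because a tie of \<open>r\<close> means a common block. This form is a list of convex
  conditions.\<close>

lemma open_order_cell_alt:
  assumes "r \<in> colorings \<pi> A"
  shows "open_order_cell \<pi> a r = {x. (\<forall>i. 0 \<le> x $ i \<and> x $ i \<le> a) \<and>
     (\<forall>i j. same_block \<pi> i j \<longrightarrow> x $ i = x $ j) \<and> (\<forall>i j. r i < r j \<longrightarrow> x $ i < x $ j)}"
    (is "_ = ?R")
proof (intro subset_antisym subsetI)
  fix x assume "x \<in> ?R"
  then have x: "\<And>i. 0 \<le> x $ i \<and> x $ i \<le> a" "\<And>i j. same_block \<pi> i j \<Longrightarrow> x $ i = x $ j"
    "\<And>i j. r i < r j \<Longrightarrow> x $ i < x $ j" by auto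
  have "x $ i < x $ j \<longleftrightarrow> r i < r j" "x $ i = x $ j \<longleftrightarrow> same_block \<pi> i j" for i j
    using x(2)[of i j] x(3)[of i j] x(3)[of j i] colorings_eq_iff[OF assms, of i j]
    by (cases "r i" "r j" rule: linorder_cases; force)+
  with x(1) show "x \<in> open_order_cell \<pi> a r"
    by (auto simp: open_order_cell_def generic_points_def)
qed (auto simp: open_order_cell_def generic_points_def)

lemma convex_open_order_cell:
  fixes \<pi> :: "'n::finite set set"
  assumes "r \<in> colorings \<pi> A"
  shows "convex (open_order_cell \<pi> a r)"
proof -
  have "open_order_cell \<pi> a r = cbox 0 (\<chi> i. a) \<inter>
      (\<Inter>(i, j)\<in>{(i, j). same_block \<pi> i j}. {x. x $ i = x $ j}) \<inter>
      (\<Inter>(i, j)\<in>{(i, j). r i < r j}. {x. x $ i < x $ j})"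
    unfolding open_order_cell_alt[OF assms] by (auto simp: mem_box_cart)
  moreover have "convex {x :: real ^ 'n. x $ i = x $ j}" for i j
    by (auto simp: convex_def)
  moreover have "convex {x :: real ^ 'n. x $ i < x $ j}" for i j
  proof -
    have "{x :: real ^ 'n. x $ i < x $ j} = {x. inner (axis i 1 - axis j 1) x < 0}"
      by (auto simp: inner_diff_left inner_axis')
    then show ?thesis by (simp add: convex_halfspace_lt)
  qed
  ultimately show ?thesis
    by (auto intro!: convex_Int convex_INT split: prod.splits)
qed

text \<open>The cell is convex, hence connected. It is maximal because a connected set in which
  \<open>x $ i - x $ j\<close> changes sign or vanishes at some point contains a zero of it, and
  among generic points a zero forces \<open>i\<close> and \<open>j\<close> into one block.\<close>

lemma connected_component_generic_points:
  fixes \<pi> :: "'n::finite set set"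
  assumes \<pi>: "partition_on UNIV \<pi>" and x: "x \<in> generic_points \<pi> {0..a}"
  shows "connected_component_set (generic_points \<pi> {0..a}) x =
    open_order_cell \<pi> a (value_rank (($) x))"
    (is "connected_component_set ?D x = ?C")
proof (rule connected_component_unique)
  have "value_rank (($) x) \<in> colorings \<pi> {..<card \<pi>}"
    using x by (intro value_rank_colorings[OF \<pi>]) (auto simp: generic_points_def)
  then show "connected ?C"
    by (intro convex_connected convex_open_order_cell)
  show "x \<in> ?C" using x by (simp add: open_order_cell_def value_rank_less_iff)
  show "?C \<subseteq> ?D" by (auto simp: open_order_cell_def)
  fix S assume S: "x \<in> S" "S \<subseteq> ?D" "connected S"
  have less: "y $ i < y $ j" if y: "y \<in> S" "z \<in> S" "z $ i < z $ j" for y z i j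
  proof (rule ccontr)
    assume "\<not> y $ i < y $ j"
    then have "\<exists>w\<in>S. inner (axis i 1 - axis j 1) w = 0"
      using y by (intro connected_ivt_hyperplane[OF S(3) y(2,1)])
        (auto simp: inner_diff_left inner_axis')
    then obtain w where w: "w \<in> S" "w $ i = w $ j"
      by (auto simp: inner_diff_left inner_axis')
    then have "same_block \<pi> i j" using S(2) by (auto simp: generic_points_def)
    then have "z $ i = z $ j" using y(2) S(2) by (auto simp: generic_points_def)
    with y(3) show False by simp
  qed
  show "S \<subseteq> ?C"
  proof
    fix y assume y: "y \<in> S"
    have "x $ i < x $ j \<longleftrightarrow> y $ i < y $ j" for i j
      using less[OF y S(1)] less[OF S(1) y] by (rule iffI)
    then show "y \<in> ?C"
      using y S(2) by (simp add: open_order_cell_def value_rank_less_iff subsetD)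
  qed
qed

text \<open>The ranks are spread over the interval in steps of \<open>a / card \<pi>\<close>; being
  below \<open>card \<pi>\<close>, they stay within the bound \<open>a\<close>.\<close>

lemma ranking_in_open_order_cell:
  fixes \<pi> :: "'n::finite set set"
  assumes "a > 0" and r: "r \<in> colorings \<pi> {..<card \<pi>}"
  shows "(\<chi> i. real (r i) * (a / real (card \<pi>))) \<in> open_order_cell \<pi> a r"
proof -
  have lt: "r i < card \<pi>" for i using colorings_mem[OF r] by auto
  then have "card \<pi> > 0" by (metis gr_zeroI not_less0)
  moreover have "real (r i) * (a / real (card \<pi>)) \<le> a" for i
    using lt[of i] assms(1) by (simp add: field_simps)
  ultimately show ?thesis
    unfolding open_order_cell_alt[OF r] using assms(1) colorings_eq_iff[OF r]
    by (auto simp: divide_strict_right_mono)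
qed

text \<open>The weak conditions are closed. Conversely, any \<open>y\<close> satisfying them is
  approached along the segment from a point \<open>x\<close> of the open cell.\<close>

lemma closure_open_order_cell:
  fixes \<pi> :: "'n::finite set set"
  assumes "a > 0" and r: "r \<in> colorings \<pi> {..<card \<pi>}"
  shows "closure (open_order_cell \<pi> a r) = order_cell \<pi> a r"
proof (rule subset_antisym)
  have "order_cell \<pi> a r = (\<Inter>i. {x. 0 \<le> x $ i} \<inter> {x. x $ i \<le> a}) \<inter>
      (\<Inter>(i, j)\<in>{(i, j). same_block \<pi> i j}. {x. x $ i = x $ j}) \<inter>
      (\<Inter>(i, j)\<in>{(i, j). r i < r j}. {x. x $ i \<le> x $ j})"
    unfolding order_cell_def by auto
  then have "closed (order_cell \<pi> a r)"
    by (auto intro!: closed_Int closed_INT closed_Collect_le closed_Collect_eq continuous_intros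
        split: prod.splits)
  moreover have "open_order_cell \<pi> a r \<subseteq> order_cell \<pi> a r"
    unfolding open_order_cell_alt[OF r] order_cell_def by (auto intro: less_imp_le)
  ultimately show "closure (open_order_cell \<pi> a r) \<subseteq> order_cell \<pi> a r"
    by (rule closure_minimal[rotated])
  show "order_cell \<pi> a r \<subseteq> closure (open_order_cell \<pi> a r)"
  proof
    fix y assume y: "y \<in> order_cell \<pi> a r"
    obtain x where x: "x \<in> open_order_cell \<pi> a r"
      using ranking_in_open_order_cell[OF assms] by blast
    \<comment> \<open>Away from \<open>y\<close> the weight \<open>1 - u\<close> of \<open>x\<close>
      is positive, so the strict inequalities of \<open>x\<close> survive the combination with the
      weak ones of \<open>y\<close>.\<close>
    have "open_segment x y \<subseteq> open_order_cell \<pi> a r"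
    proof
      fix z assume "z \<in> open_segment x y"
      then obtain u where u: "0 < u" "u < 1" "z = (1 - u) *\<^sub>R x + u *\<^sub>R y"
        by (auto simp: in_segment)
      have "z \<in> order_cell \<pi> a r" "\<And>i j. r i < r j \<Longrightarrow> z $ i < z $ j"
      proof -
        show "z $ i < z $ j" if "r i < r j" for i j
        proof -
          have "x $ i < x $ j" "y $ i \<le> y $ j"
            using that x y by (auto simp: open_order_cell_def order_cell_def)
          then show ?thesis using u by (simp add: add_less_le_mono)
        qed
        moreover have "0 \<le> z $ i" for i
          using x y u by (simp add: open_order_cell_alt[OF r] order_cell_def)
        moreover have "z $ i \<le> a" for i
          using x y u by (auto simp: open_order_cell_alt[OF r] order_cell_def intro!: convex_bound_le)
        moreover have "z $ i = z $ j" if "same_block \<pi> i j" for i j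
        proof -
          have "x $ i = x $ j" "y $ i = y $ j"
            using that x y by (auto simp: open_order_cell_alt[OF r] order_cell_def)
          then show ?thesis by (simp add: u(3))
        qed
        ultimately show "z \<in> order_cell \<pi> a r" by (auto simp: order_cell_def intro: less_imp_le)
      qed
      then show "z \<in> open_order_cell \<pi> a r"
        by (auto simp: open_order_cell_alt[OF r] order_cell_def)
    qed
    then have "closure (open_segment x y) \<subseteq> closure (open_order_cell \<pi> a r)"
      by (rule closure_mono)
    moreover have "y \<in> closure (open_segment x y)" if "x \<noteq> y"
      using that by simp
    ultimately show "y \<in> closure (open_order_cell \<pi> a r)"
      using x closure_subset by blast
  qed
qed

text \<open>Each component is the open cell of the value rank of any of its points, and every
  ranking occurs because its open cell is nonempty.\<close>

lemma closed_regions_orbit_polytope: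
  fixes E \<pi> :: "'n::finite set set"
  assumes \<pi>: "partition_on UNIV \<pi>" and "\<forall>B\<in>\<pi>. independent_in E B" "a > 0"
  shows "closed_regions ((\<lambda>x. a *\<^sub>R x) ` orbit_polytope \<pi>) (orbit_arrangement E \<pi>) =
    order_cell \<pi> a ` colorings \<pi> {..<card \<pi>}"
proof -
  have "components (generic_points \<pi> {0..a}) = open_order_cell \<pi> a ` colorings \<pi> {..<card \<pi>}"
  proof (intro subset_antisym subsetI)
    fix C assume "C \<in> components (generic_points \<pi> {0..a})"
    then obtain x where x: "x \<in> generic_points \<pi> {0..a}"
      "C = connected_component_set (generic_points \<pi> {0..a}) x"
      by (auto simp: components_def)
    then have "C = open_order_cell \<pi> a (value_rank (($) x))"
      by (simp add: connected_component_generic_points[OF \<pi>])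
    moreover have "value_rank (($) x) \<in> colorings \<pi> {..<card \<pi>}"
      using x by (intro value_rank_colorings[OF \<pi>]) (auto simp: generic_points_def)
    ultimately show "C \<in> open_order_cell \<pi> a ` colorings \<pi> {..<card \<pi>}" by blast
  next
    fix C assume "C \<in> open_order_cell \<pi> a ` colorings \<pi> {..<card \<pi>}"
    then obtain r where r: "r \<in> colorings \<pi> {..<card \<pi>}" "C = open_order_cell \<pi> a r" by blast
    obtain x where x: "x \<in> open_order_cell \<pi> a r"
      using ranking_in_open_order_cell[OF assms(3) r(1)] by blast
    then have D: "x \<in> generic_points \<pi> {0..a}" by (simp add: open_order_cell_def)
    have "value_rank (($) x) = value_rank r"
      using x by (intro value_rank_cong) (simp add: open_order_cell_def)
    then have "C = connected_component_set (generic_points \<pi> {0..a}) x"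
      using r by (simp add: connected_component_generic_points[OF \<pi> D] value_rank_ranking[OF \<pi>])
    with D show "C \<in> components (generic_points \<pi> {0..a})"
      by (auto simp: components_def)
  qed
  moreover have "closure (open_order_cell \<pi> a r) = order_cell \<pi> a r"
    if "r \<in> colorings \<pi> {..<card \<pi>}" for r
    using closure_open_order_cell[OF assms(3) that] .
  ultimately show ?thesis
    unfolding closed_regions_def scaled_orbit_polytope_Diff[OF assms]
    by (simp add: image_image cong: image_cong_simp)
qed

text \<open>Distinct rankings must give distinct regions for multiplicities to count rankings. A
  point of the open cell of \<open>r\<close> that lies in the cell of \<open>r'\<close> forbids
  \<open>r'\<close> to reverse any strict comparison of \<open>r\<close>.\<close>

lemma inj_on_order_cell:
  fixes \<pi> :: "'n::finite set set"
  assumes "partition_on UNIV \<pi>" "a > 0"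
  shows "inj_on (order_cell \<pi> a) (colorings \<pi> {..<card \<pi>})"
proof (rule inj_onI)
  fix r r' assume r: "r \<in> colorings \<pi> {..<card \<pi>}" "r' \<in> colorings \<pi> {..<card \<pi>}"
    and eq: "order_cell \<pi> a r = order_cell \<pi> a r'"
  obtain x where x: "x \<in> open_order_cell \<pi> a r"
    using ranking_in_open_order_cell[OF assms(2) r(1)] by blast
  then have "x \<in> order_cell \<pi> a r'"
    using closure_open_order_cell[OF assms(2) r(1)] closure_subset eq by blast
  then have le: "x $ i \<le> x $ j" if "r' i < r' j" for i j
    using that by (simp add: order_cell_def)
  show "r = r'"
  proof (rule ranking_eqI[OF assms(1) r])
    fix i j assume less: "r i < r j"
    then have "x $ i < x $ j" using x by (simp add: open_order_cell_def)
    then have "\<not> r' j < r' i" using le[of j i] by auto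
    moreover have "r' i \<noteq> r' j"
      using less colorings_eq_iff[OF r(1)] colorings_eq_iff[OF r(2)] by (metis less_irrefl)
    ultimately show "r' i < r' j" by simp
  qed
qed

lemma region_multiplicity_orbit_polytope:
  fixes E \<pi> :: "'n::finite set set"
  assumes "partition_on UNIV \<pi>" "\<forall>B\<in>\<pi>. independent_in E B" "a > 0"
    and x: "x \<in> (\<lambda>x. a *\<^sub>R x) ` orbit_polytope \<pi>"
  shows "region_multiplicity ((\<lambda>x. a *\<^sub>R x) ` orbit_polytope \<pi>) (orbit_arrangement E \<pi>) x =
    card (compatible_rankings \<pi> (($) x))"
proof -
  have "{R \<in> order_cell \<pi> a ` colorings \<pi> {..<card \<pi>}. x \<in> R} =
      order_cell \<pi> a ` compatible_rankings \<pi> (($) x)"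
    using x unfolding scaled_orbit_polytope[OF assms(3)]
    by (auto simp: compatible_rankings_def order_cell_def)
  moreover have "inj_on (order_cell \<pi> a) (compatible_rankings \<pi> (($) x))"
    by (rule inj_on_subset[OF inj_on_order_cell[OF assms(1,3)]])
      (auto simp: compatible_rankings_def)
  ultimately show ?thesis
    using x by (simp add: region_multiplicity_def closed_regions_orbit_polytope[OF assms(1-3)]
        card_image)
qed

section \<open>Lattice point counts\<close>

definition lattice_point :: "('n \<Rightarrow> nat) \<Rightarrow> real ^ 'n" where
  "lattice_point y = (\<chi> i. real (y i))"

lemma lattice_point_nth [simp]: "lattice_point y $ i = real (y i)"
  by (simp add: lattice_point_def)

lemma inj_lattice_point: "inj lattice_point"
  by (rule injI) (metis ext lattice_point_nth of_nat_eq_iff)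

lemma lattice_point_in_integer_points: "lattice_point y \<in> integer_points"
  by (simp add: integer_points_def)

lemma integer_point_nonneg_cases:
  assumes "x \<in> integer_points" "\<And>i. 0 \<le> x $ i"
  obtains y where "x = lattice_point y"
proof -
  have "x = lattice_point (\<lambda>i. nat \<lfloor>x $ i\<rfloor>)"
    using assms by (auto simp: vec_eq_iff integer_points_def)
  then show thesis by (rule that)
qed

lemma closed_ehrhart_orbit_polytope:
  fixes E \<pi> :: "'n::finite set set"
  assumes "partition_on UNIV \<pi>" "\<forall>B\<in>\<pi>. independent_in E B" "t \<ge> 1"
  shows "closed_ehrhart (orbit_polytope \<pi>) (orbit_arrangement E \<pi>) t =
    (\<Prod>i<card \<pi>. real t + real i + 1)"
proof -
  let ?Q = "(\<lambda>x. real t *\<^sub>R x) ` orbit_polytope \<pi>"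
  let ?m = "region_multiplicity ?Q (orbit_arrangement E \<pi>)"
  have t: "real t > 0" using assms(3) by simp
  have mem: "lattice_point y \<in> ?Q \<longleftrightarrow> y \<in> block_functions \<pi> t" for y
    by (simp add: scaled_orbit_polytope[OF t] block_functions_def)
  have lattice: "x \<in> lattice_point ` block_functions \<pi> t"
    if x: "x \<in> integer_points" "x \<in> ?Q" for x
  proof -
    from x(2) have "0 \<le> x $ i" for i
      by (auto simp: scaled_orbit_polytope[OF t])
    then obtain y where y: "x = lattice_point y"
      using integer_point_nonneg_cases[OF x(1)] by metis
    then have "y \<in> block_functions \<pi> t"
      using x(2) by (simp only: mem)
    then show ?thesis by (simp only: y imageI)
  qed
  \<comment> \<open>Outside the dilate the multiplicity is \<open>0\<close>, so the infinite sum has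
    its support in the finite set of block functions.\<close>
  have "closed_ehrhart (orbit_polytope \<pi>) (orbit_arrangement E \<pi>) t =
      (\<Sum>\<^sub>\<infinity>x\<in>lattice_point ` block_functions \<pi> t. real (?m x))"
    unfolding closed_ehrhart_def using lattice_point_in_integer_points lattice
    by (intro infsum_cong_neutral) (auto simp: region_multiplicity_def)
  also have "\<dots> = (\<Sum>y\<in>block_functions \<pi> t. real (?m (lattice_point y)))"
    by (simp add: finite_block_functions sum.reindex inj_on_subset[OF inj_lattice_point])
  also have "\<dots> = (\<Sum>y\<in>block_functions \<pi> t. real (card (compatible_rankings \<pi> y)))"
    by (intro sum.cong refl)
      (simp add: region_multiplicity_orbit_polytope[OF assms(1,2) t] mem compatible_rankings_def)
  also have "\<dots> = real (\<Prod>i<card \<pi>. t + card \<pi> - i)"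
    by (simp flip: sum_card_compatible_rankings[OF assms(1)])
  \<comment> \<open>Reversing the index, \<open>i\<close> to \<open>card \<pi> - Suc i\<close>,
    turns \<open>t + card \<pi> - i\<close> into \<open>t + i + 1\<close>.\<close>
  also have "\<dots> = (\<Prod>i<card \<pi>. real t + real i + 1)"
    by (simp only: of_nat_prod, rule prod.reindex_bij_witness[of _ "\<lambda>i. card \<pi> - Suc i" "\<lambda>i. card \<pi> - Suc i"])
      (auto simp: of_nat_diff)
  finally show ?thesis .
qed

lemma orbital_chromatic_eq_card_colorings:
  assumes "\<forall>B\<in>\<pi>. independent_in E B"
  shows "orbital_chromatic E \<pi> t = card (colorings \<pi> {1..t})"
proof -
  have "\<not> same_block \<pi> i j" if "{i, j} \<in> E" for i j
    using that assms by (auto simp: same_block_def independent_in_def)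
  then have "{c. proper_coloring E t c \<and> coloring_lies_in c \<pi>} = colorings \<pi> {1..t}"
    by (auto simp: proper_coloring_def colorings_def coloring_lies_in_def)
  then show ?thesis by (simp add: orbital_chromatic_def)
qed

text \<open>An integer strictly between \<open>0\<close> and \<open>t\<close> lies in
  \<open>{1..t - 1}\<close>: this is the source of the shift from \<open>t\<close> to
  \<open>t - 1\<close> colors.\<close>

lemma open_ehrhart_orbit_polytope:
  fixes E \<pi> :: "'n::finite set set"
  assumes "partition_on UNIV \<pi>" "\<forall>B\<in>\<pi>. independent_in E B" "t \<ge> 1"
  shows "open_ehrhart (orbit_polytope \<pi>) (orbit_arrangement E \<pi>) t =
    card (colorings \<pi> {1..t - 1})"
proof -
  have t: "real t > 0" using assms(3) by simp
  have "integer_points \<inter> generic_points \<pi> {0<..<real t} = lattice_point ` colorings \<pi> {1..t - 1}"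
  proof (intro subset_antisym subsetI)
    fix x assume x: "x \<in> integer_points \<inter> generic_points \<pi> {0<..<real t}"
    then have "x \<in> integer_points" "\<And>i. 0 \<le> x $ i"
      by (auto simp: generic_points_def intro: less_imp_le)
    then obtain y where y: "x = lattice_point y"
      using integer_point_nonneg_cases by blast
    have "y \<in> colorings \<pi> {1..t - 1}"
    proof (rule coloringsI)
      fix i
      have "0 < y i \<and> y i < t" using x by (auto simp: y generic_points_def)
      then show "y i \<in> {1..t - 1}" by auto
    qed (use x in \<open>auto simp: y generic_points_def\<close>)
    with y show "x \<in> lattice_point ` colorings \<pi> {1..t - 1}" by blast
  next
    fix x assume "x \<in> lattice_point ` colorings \<pi> {1..t - 1}"
    then obtain y where y: "y \<in> colorings \<pi> {1..t - 1}" "x = lattice_point y" by blast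
    have "0 < y i \<and> y i < t" for i using colorings_mem[OF y(1), of i] by auto
    then show "x \<in> integer_points \<inter> generic_points \<pi> {0<..<real t}"
      using y colorings_eq_iff[OF y(1)]
      by (auto simp: generic_points_def lattice_point_in_integer_points)
  qed
  then show ?thesis
    unfolding open_ehrhart_def scaled_rel_interior_orbit_polytope_Diff[OF assms(1,2) t]
    by (simp add: card_image inj_on_subset[OF inj_lattice_point])
qed

section \<open>The two polynomials and reciprocity\<close>

theorem theorem5p10:
  fixes E \<pi> :: "'n::finite set set"
  assumes "simple_graph_edges E"
    and "partition_on UNIV \<pi>"
    and "\<And>B. B \<in> \<pi> \<Longrightarrow> independent_in E B"
  shows "(\<exists>p :: real poly.
           (\<forall>t::nat. t \<ge> 1 \<longrightarrow>
              poly p (real t) = closed_ehrhart (orbit_polytope \<pi>) (orbit_arrangement E \<pi>) t) \<and>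
           (\<forall>t::nat. t \<ge> 1 \<longrightarrow>
              (-1) ^ card \<pi> * poly p (- real t) =
                real (open_ehrhart (orbit_polytope \<pi>) (orbit_arrangement E \<pi>) t) \<and>
              open_ehrhart (orbit_polytope \<pi>) (orbit_arrangement E \<pi>) t =
                orbital_chromatic E \<pi> (t - 1)))
       \<and> (\<exists>q :: real poly.
           (\<forall>t::nat. poly q (real t) = real (orbital_chromatic E \<pi> t)) \<and>
           degree q = card \<pi> \<and> lead_coeff q = 1)"
proof -
  let ?s = "card \<pi>"
  have indep: "\<forall>B\<in>\<pi>. independent_in E B"
    by (rule ballI) (rule assms(3))
  \<comment> \<open>The roots of \<open>p\<close> are \<open>-1, ..., -s\<close> and those of
    \<open>q\<close> are \<open>0, ..., s - 1\<close>. The substitution of \<open>-t\<close> in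
    \<open>p\<close> and of \<open>t - 1\<close> in \<open>q\<close> matches them up to one sign per
    factor.\<close>
  define p :: "real poly" where "p = (\<Prod>i<?s. [:real i + 1, 1:])"
  define q :: "real poly" where "q = (\<Prod>i<?s. [:- real i, 1:])"
  have chromatic: "real (orbital_chromatic E \<pi> t) = (\<Prod>i<?s. real t - real i)" for t
    using real_prod_falling[of t ?s]
    by (simp add: orbital_chromatic_eq_card_colorings[OF indep] card_colorings[OF assms(2)]
        del: of_nat_prod)
  have op: "open_ehrhart (orbit_polytope \<pi>) (orbit_arrangement E \<pi>) t = orbital_chromatic E \<pi> (t - 1)"
    if "t \<ge> 1" for t
    using open_ehrhart_orbit_polytope[OF assms(2) indep that]
    by (simp add: orbital_chromatic_eq_card_colorings[OF indep])
  have "poly p (real t) = closed_ehrhart (orbit_polytope \<pi>) (orbit_arrangement E \<pi>) t"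
    if "t \<ge> 1" for t
    by (simp add: p_def poly_prod closed_ehrhart_orbit_polytope[OF assms(2) indep that] algebra_simps)
  moreover have "(-1) ^ ?s * poly p (- real t) = real (orbital_chromatic E \<pi> (t - 1))"
    if "t \<ge> 1" for t
  proof -
    have "(-1) ^ ?s * poly p (- real t) = (\<Prod>i<?s. (- 1) * (real i + 1 - real t))"
      by (simp only: p_def poly_prod prod.distrib prod_constant card_lessThan) simp
    also have "\<dots> = real (orbital_chromatic E \<pi> (t - 1))"
      \<comment> \<open>Here \<open>t \<ge> 1\<close> makes the natural number \<open>t - 1\<close>
        agree with the real difference.\<close>
      unfolding chromatic using that by (intro prod.cong refl) (simp add: of_nat_diff)
    finally show ?thesis .
  qed
  moreover have "poly q (real t) = real (orbital_chromatic E \<pi> t)" for t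
    by (simp add: q_def poly_prod chromatic)
  moreover have "degree q = ?s"
    by (simp add: q_def degree_prod_sum_eq)
  moreover have "lead_coeff q = 1"
    unfolding q_def lead_coeff_prod by simp
  ultimately show ?thesis using op by (intro conjI exI[of _ p] exI[of _ q]) auto
qed

end
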